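(* Let $n\ge 2$ be an integer, $a,b\in\mathbb{R}$ and $p,q>1$. Assume that $$\frac1p+\frac1q<1\qquad\text{and}\qquad \frac{a+n}{p}+\frac{b+n}{q}=n-2 .$$ Let $u,v\in C^2(\mathbb{R}^n\setminus\{0\})$ be a radially symmetric solution to $$-\Delta u=|x|^a|v|^{p-2}v,\qquad -\Delta v=|x|^{b}|u|^{q-2}u\qquad\text{on }\mathbb{R}^n\setminus\{0\}.$$ (i) If $a>-n$, $b>-n$ and if $$\lim_{|x|\to \infty}|x|^{\frac{b+n}{q}} u(x)=\lim_{x\to 0}|x|^{\frac{b+n}{q}} u(x)=\lim_{|x|\to \infty}|x|^{\frac{a+n}{p}}v(x)=\lim_{x\to 0}|x|^{\frac{a+n}{p}}v(x)=0,$$ then either $u\equiv v\equiv 0$ or $uv>0$ on $\mathbb{R}^n\setminus\{0\}$. (ii) Assume that either the limits $\lim_{|x|\to \infty}|x|^{\frac{b+n}{q}} u(x)$ and $\lim_{|x|\to \infty}|x|^{\frac{a+n}{p}}v(x)$ both exist and are finite, or the limits $\lim_{x\to 0}|x|^{\frac{b+n}{q}} u(x)$ and $\lim_{x\to 0}|x|^{\frac{a+n}{p}}v(x)$ both exist and are finite. If $a\le -n$ or $b\le -n$, and if $u\ge 0$ and $v\ge 0$, then $u\equiv v\equiv 0$.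
   Context: The expression $|t|^{r-2}t$ with $r>1$ is understood to be $0$ at $t=0$. Radially symmetric means that both $u$ and $v$ depend only on $|x|$. *)

theory Defs
  imports "HOL-Analysis.Analysis"
begin

definition partial_deriv :: "'a::euclidean_space \<Rightarrow> ('a \<Rightarrow> real) \<Rightarrow> 'a \<Rightarrow> real" where
  "partial_deriv i f x = frechet_derivative f (at x) i"

text \<open>Intended for open \<open>S\<close>, so that the value of \<open>f\<close> outside \<open>S\<close> is irrelevant.\<close>

primrec C_on :: "nat \<Rightarrow> 'a::euclidean_space set \<Rightarrow> ('a \<Rightarrow> real) \<Rightarrow> bool" where
  "C_on 0 S f \<longleftrightarrow> continuous_on S f"
| "C_on (Suc k) S f \<longleftrightarrow>
     (\<forall>x\<in>S. f differentiable (at x)) \<and> (\<forall>i\<in>Basis. C_on k S (partial_deriv i f))"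

definition laplacian :: "('a::euclidean_space \<Rightarrow> real) \<Rightarrow> 'a \<Rightarrow> real" where
  "laplacian f x = (\<Sum>i\<in>Basis. partial_deriv i (partial_deriv i f) x)"

definition radial_on :: "'a::real_normed_vector set \<Rightarrow> ('a \<Rightarrow> 'b) \<Rightarrow> bool" where
  "radial_on S f \<longleftrightarrow> (\<forall>x\<in>S. \<forall>y\<in>S. norm x = norm y \<longrightarrow> f x = f y)"

text \<open>The expression \<open>|t|\<^sup>r\<^sup>-\<^sup>2 t\<close>, which is \<open>0\<close> at \<open>t = 0\<close> because of the factor \<open>t\<close>.\<close>

definition signed_pow :: "real \<Rightarrow> real \<Rightarrow> real" where
  "signed_pow r t = \<bar>t\<bar> powr (r - 2) * t"

end

theory Submission
  imports Defs
begin

text \<open>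
  Put \<open>\<alpha> = (b + n) / q\<close> and \<open>\<beta> = (a + n) / p\<close>, so that \<open>\<alpha> + \<beta> = n - 2\<close>. In the logarithmic
  radius \<open>t = ln |x|\<close> the weighted functions \<open>f = |x|\<^sup>\<alpha> u\<close> and \<open>g = |x|\<^sup>\<beta> v\<close> of a radial solution
  satisfy an autonomous system on the whole line (\<open>emden_fowler_log_profile\<close>):
  \<open>f'' + (\<beta> - \<alpha>) f' - \<alpha> \<beta> f = - |g|\<^sup>p\<^sup>-\<^sup>2 g\<close> and
  \<open>g'' - (\<beta> - \<alpha>) g' - \<alpha> \<beta> g = - |f|\<^sup>q\<^sup>-\<^sup>2 f\<close>. The limits of the weighted functions
  become limits of \<open>f\<close> and \<open>g\<close>, and these force the derivatives to tend to zero
  (\<open>limit_forces_derivative_limit\<close>).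

  The system has the first integral \<open>f' g' - \<alpha> \<beta> f g + |f|\<^sup>q / q + |g|\<^sup>p / p\<close>. In (i) it vanishes
  and \<open>\<alpha> \<beta> \<ge> 0\<close>. Hence \<open>f' g' < 0\<close> wherever \<open>f g \<le> 0\<close> and \<open>(f, g) \<noteq> (0, 0)\<close>. In one of the two
  time directions \<open>f\<close> and \<open>g\<close> then move apart forever, against their decay
  (\<open>runaway_forward\<close>). So \<open>f g > 0\<close> except at common zeros. At a common zero the first integral
  gives \<open>f' g' = 0\<close>, say \<open>g' = 0\<close>. Up to the symmetries of the system, if \<open>f\<close> and
  \<open>g\<close> are positive to the right of this zero, integrating the inequality \<open>(D - \<beta>) (D + \<alpha>) g < 0\<close> from the zero yields \<open>g < 0\<close> there, which
  is absurd (\<open>negative_after_double_zero\<close>). So one common zero makes the solution trivial. This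
  argument replaces uniqueness for the initial value problem, which is not at hand because the
  nonlinearities need not be Lipschitz.

  In (ii) one has \<open>\<alpha> \<beta> \<le> 0\<close>. After a suitable exchange of \<open>f\<close> and \<open>g\<close> and a reflection of time,
  \<open>\<beta> \<le> \<alpha>\<close> and the limits are those at \<open>+\<infinity>\<close>. Passing to the limit in the equations gives
  \<open>f \<rightarrow> 0\<close> and \<open>f' \<rightarrow> 0\<close>. As \<open>exp ((\<beta> - \<alpha>) t) f'\<close> is nonincreasing with limit zero, \<open>f\<close> increases
  to zero while being nonnegative, so \<open>f = 0\<close> and then \<open>g = 0\<close> (\<open>nonneg_solution_zero\<close>).
\<close>

section \<open>Signed powers\<close>

lemma signed_pow_nonneg_eq: "t \<ge> 0 \<Longrightarrow> signed_pow r t = t powr (r - 1)"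
  by (cases "t = 0") (auto simp: signed_pow_def powr_diff power2_eq_square)

lemma signed_pow_0 [simp]: "signed_pow r 0 = 0"
  by (simp add: signed_pow_def)

lemma signed_pow_minus [simp]: "signed_pow r (- t) = - signed_pow r t"
  by (simp add: signed_pow_def)

lemma signed_pow_nonneg: "t \<ge> 0 \<Longrightarrow> signed_pow r t \<ge> 0"
  by (simp add: signed_pow_def)

lemma signed_pow_pos: "t > 0 \<Longrightarrow> signed_pow r t > 0"
  by (simp add: signed_pow_def)

lemma signed_pow_eq_0_iff [simp]: "signed_pow r t = 0 \<longleftrightarrow> t = 0"
  by (simp add: signed_pow_def)

lemma abs_signed_pow: "\<bar>signed_pow r t\<bar> = \<bar>t\<bar> powr (r - 1)"
  using signed_pow_nonneg_eq[of "\<bar>t\<bar>" r] by (simp add: signed_pow_def abs_mult)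

lemma signed_pow_scale: "s > 0 \<Longrightarrow> signed_pow r (s * t) = s powr (r - 1) * signed_pow r t"
  by (simp add: signed_pow_def abs_mult powr_mult powr_diff power2_eq_square)

lemma isCont_signed_pow:
  assumes "r > 1"
  shows "isCont (signed_pow r) t"
proof (cases "t = 0")
  case True
  have "((\<lambda>x. \<bar>x\<bar> powr (r - 1)) \<longlongrightarrow> 0) (at 0)"
    using assms by (intro tendsto_eq_intros | simp)+
  then have "((\<lambda>x. \<bar>signed_pow r x\<bar>) \<longlongrightarrow> 0) (at 0)"
    by (simp add: abs_signed_pow)
  then show ?thesis
    using True by (simp add: isCont_def tendsto_rabs_zero_iff)
next
  case False
  then have "isCont (\<lambda>t. \<bar>t\<bar> powr (r - 2) * t) t"
    by (intro continuous_intros) auto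
  then show ?thesis
    by (simp add: signed_pow_def[abs_def])
qed

lemma abs_powr_has_real_derivative:
  assumes "r > 1"
  shows "((\<lambda>x. \<bar>x\<bar> powr r) has_real_derivative r * signed_pow r t) (at t)"
proof -
  have pos: "((\<lambda>x. \<bar>x\<bar> powr r) has_real_derivative r * signed_pow r s) (at s)" if "s > 0" for s
  proof -
    have "((\<lambda>x. x powr r) has_real_derivative r * signed_pow r s) (at s)"
      using that by (auto intro!: derivative_eq_intros simp: signed_pow_nonneg_eq)
    then show ?thesis
      by (rule has_field_derivative_transform_within_open[where S = "{0<..}"]) (use that in auto)
  qed
  consider "t > 0" | "t < 0" | "t = 0" by linarith
  then show ?thesis
  proof cases
    case 1
    then show ?thesis by (rule pos)
  next
    case 2
    then have "((\<lambda>x. \<bar>- x\<bar> powr r) has_real_derivative r * signed_pow r (- t) * (- 1)) (at t)"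
      by (intro DERIV_chain2[OF pos]) (auto intro!: derivative_eq_intros)
    then show ?thesis by simp
  next
    case 3
    have "(signed_pow r \<longlongrightarrow> 0) (at 0)"
      using isCont_signed_pow[OF assms, of 0] by (simp add: isCont_def)
    moreover have "\<bar>h\<bar> powr r / h = signed_pow r h" if "h \<noteq> 0" for h
      using that by (simp add: signed_pow_def powr_diff power2_eq_square)
    ultimately have "((\<lambda>h. \<bar>h\<bar> powr r / h) \<longlongrightarrow> 0) (at 0)"
      by (subst tendsto_cong[where g = "signed_pow r"])
        (auto simp: eventually_at_filter)
    then show ?thesis
      using 3 by (simp add: DERIV_def)
  qed
qed

section \<open>Limits and derivatives at infinity\<close>

text \<open>
  If \<open>f'' + c f' = h\<close> and both \<open>f\<close> and \<open>h\<close> converge at infinity, then \<open>h\<close> and \<open>f'\<close> tend to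
  zero. The mean value theorem yields points \<open>\<eta> t\<close> within distance one of \<open>t\<close> where \<open>f'\<close> is small,
  and \<open>f' + c f\<close>, whose derivative is \<open>h\<close>, is controlled between these points.
\<close>

lemma limit_forces_derivative_limit:
  fixes f f' h :: "real \<Rightarrow> real"
  assumes f: "\<And>t. (f has_real_derivative f' t) (at t)"
    and f': "\<And>t. (f' has_real_derivative h t - c * f' t) (at t)"
    and lim_f: "(f \<longlongrightarrow> L) at_top" and lim_h: "(h \<longlongrightarrow> H) at_top"
  shows "H = 0" and "(f' \<longlongrightarrow> 0) at_top"
proof -
  define F where "F t = f' t + c * f t" for t
  have F: "(F has_real_derivative h t) (at t)" for t
    unfolding F_def by (auto intro!: derivative_eq_intros f f')
  have "\<exists>z. t < z \<and> z < t + 1 \<and> f (t + 1) - f t = f' z" for t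
    using MVT2[of t "t + 1" f f'] f by auto
  then obtain \<eta> where \<eta>: "\<And>t. t < \<eta> t" "\<And>t. \<eta> t < t + 1" "\<And>t. f (t + 1) - f t = f' (\<eta> t)"
    by metis
  have top: "filterlim \<tau> at_top at_top" if "\<And>t. t \<le> \<tau> t" for \<tau> :: "real \<Rightarrow> real"
    by (rule filterlim_at_top_mono[OF filterlim_ident]) (use that in auto)
  have "((\<lambda>t. f (t + 1) - f t) \<longlongrightarrow> L - L) at_top"
    by (intro tendsto_diff lim_f filterlim_compose[OF lim_f top]) auto
  then have f'_eta: "((\<lambda>t. f' (\<eta> t)) \<longlongrightarrow> 0) at_top"
    by (simp add: \<eta>(3))
  have F_eta: "((\<lambda>t. F (\<eta> t)) \<longlongrightarrow> 0 + c * L) at_top"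
    unfolding F_def
    by (intro tendsto_add f'_eta tendsto_mult_left filterlim_compose[OF lim_f top])
      (use \<eta>(1) less_imp_le in blast)
  \<comment> \<open>The shift by two separates the points: \<open>\<eta> (t + 2) - \<eta> t \<ge> 1\<close>.\<close>
  have "\<exists>z. t \<le> z \<and> F (\<eta> (t + 2)) - F (\<eta> t) = (\<eta> (t + 2) - \<eta> t) * h z" for t
    using MVT2[of "\<eta> t" "\<eta> (t + 2)" F h] F \<eta>(1)[of t] \<eta>(2)[of t] \<eta>(1)[of "t + 2"]
    by (smt (verit))
  then obtain \<xi> where \<xi>: "\<And>t. t \<le> \<xi> t"
      "\<And>t. F (\<eta> (t + 2)) - F (\<eta> t) = (\<eta> (t + 2) - \<eta> t) * h (\<xi> t)"
    by metis
  have gap: "((\<lambda>t. F (\<eta> (t + 2)) - F (\<eta> t)) \<longlongrightarrow> (0 + c * L) - (0 + c * L)) at_top"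
    by (intro tendsto_diff F_eta filterlim_compose[OF F_eta top]) auto
  have "\<bar>h (\<xi> t)\<bar> \<le> \<bar>F (\<eta> (t + 2)) - F (\<eta> t)\<bar>" for t
  proof -
    have "1 \<le> \<eta> (t + 2) - \<eta> t"
      using \<eta>(2)[of t] \<eta>(1)[of "t + 2"] by linarith
    then show ?thesis
      unfolding \<xi>(2) abs_mult by (intro mult_le_cancel_right1[THEN iffD2]) auto
  qed
  then have "((\<lambda>t. h (\<xi> t)) \<longlongrightarrow> 0) at_top"
    by (intro Lim_null_comparison[OF _ tendsto_rabs_zero[OF gap[simplified]]]) auto
  moreover have "((\<lambda>t. h (\<xi> t)) \<longlongrightarrow> H) at_top"
    by (rule filterlim_compose[OF lim_h top[OF \<xi>(1)]])
  ultimately show H: "H = 0"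
    using tendsto_unique trivial_limit_at_top_linorder by blast
  have "\<exists>z. t \<le> z \<and> F (\<eta> t) - F t = (\<eta> t - t) * h z" for t
    using MVT2[of t "\<eta> t" F h] F \<eta>(1)[of t] by (smt (verit))
  then obtain \<zeta> where \<zeta>: "\<And>t. t \<le> \<zeta> t" "\<And>t. F (\<eta> t) - F t = (\<eta> t - t) * h (\<zeta> t)"
    by metis
  have "\<bar>F (\<eta> t) - F t\<bar> \<le> \<bar>h (\<zeta> t)\<bar>" for t
  proof -
    have "\<bar>\<eta> t - t\<bar> \<le> 1"
      using \<eta>(1,2)[of t] by linarith
    then show ?thesis
      unfolding \<zeta>(2) abs_mult by (intro mult_left_le_one_le) auto
  qed
  then have "\<forall>\<^sub>F t in at_top. norm (F (\<eta> t) - F t) \<le> \<bar>h (\<zeta> t)\<bar>"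
    by simp
  moreover have "((\<lambda>t. h (\<zeta> t)) \<longlongrightarrow> 0) at_top"
    using filterlim_compose[OF lim_h top[OF \<zeta>(1)]] H by simp
  ultimately have "((\<lambda>t. F (\<eta> t) - F t) \<longlongrightarrow> 0) at_top"
    by (rule Lim_null_comparison[OF _ tendsto_rabs_zero])
  from tendsto_diff[OF F_eta this] have "(F \<longlongrightarrow> c * L) at_top"
    by simp
  from tendsto_diff[OF this tendsto_mult_left[OF lim_f, of c]] show "(f' \<longlongrightarrow> 0) at_top"
    by (simp add: F_def)
qed

section \<open>The Emden--Fowler system\<close>

text \<open>
  The autonomous system \<open>(D - \<alpha>) (D + \<beta>) f = - |g|\<^sup>p\<^sup>-\<^sup>2 g\<close>, \<open>(D - \<beta>) (D + \<alpha>) g = - |f|\<^sup>q\<^sup>-\<^sup>2 f\<close>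
  on the whole line, \<open>D\<close> being the derivative. The functions \<open>f'\<close> and \<open>g'\<close> are the derivatives
  of \<open>f\<close> and \<open>g\<close>.
\<close>

locale emden_fowler =
  fixes \<alpha> \<beta> p q :: real and f f' g g' :: "real \<Rightarrow> real"
  assumes p: "p > 1" and q: "q > 1"
    and f: "\<And>t. (f has_real_derivative f' t) (at t)"
    and g: "\<And>t. (g has_real_derivative g' t) (at t)"
    and f': "\<And>t. (f' has_real_derivative
               (\<alpha> * \<beta> * f t - signed_pow p (g t)) - (\<beta> - \<alpha>) * f' t) (at t)"
    and g': "\<And>t. (g' has_real_derivative
               (\<alpha> * \<beta> * g t - signed_pow q (f t)) - (\<alpha> - \<beta>) * g' t) (at t)"
begin

lemma swap: "emden_fowler \<beta> \<alpha> q p g g' f f'"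
  using p q f g f' g' by unfold_locales (auto simp: mult.commute[of \<beta> \<alpha>])

text \<open>Reversing time flips the sign of \<open>\<beta> - \<alpha>\<close>, hence exchanges \<open>\<alpha>\<close> and \<open>\<beta>\<close> but not \<open>p\<close> and \<open>q\<close>.\<close>

lemma reflect:
  "emden_fowler \<beta> \<alpha> p q (\<lambda>t. f (- t)) (\<lambda>t. - f' (- t)) (\<lambda>t. g (- t)) (\<lambda>t. - g' (- t))"
proof -
  have *: "((\<lambda>t. h (- t)) has_real_derivative - y) (at t)"
    if "(h has_real_derivative y) (at (- t))" for h :: "real \<Rightarrow> real" and y t
    using that by (simp add: DERIV_mirror)
  show ?thesis
  proof unfold_locales
    fix t
    show "((\<lambda>t. - f' (- t)) has_real_derivative
        (\<beta> * \<alpha> * f (- t) - signed_pow p (g (- t))) - (\<alpha> - \<beta>) * - f' (- t)) (at t)"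
      using DERIV_minus[OF *[OF f'[of "- t"]]] by (simp add: algebra_simps)
    show "((\<lambda>t. - g' (- t)) has_real_derivative
        (\<beta> * \<alpha> * g (- t) - signed_pow q (f (- t))) - (\<beta> - \<alpha>) * - g' (- t)) (at t)"
      using DERIV_minus[OF *[OF g'[of "- t"]]] by (simp add: algebra_simps)
  qed (auto intro!: p q * f g)
qed

lemma negate:
  "emden_fowler \<alpha> \<beta> p q (\<lambda>t. - f t) (\<lambda>t. - f' t) (\<lambda>t. - g t) (\<lambda>t. - g' t)"
proof unfold_locales
  fix t
  show "((\<lambda>t. - f' t) has_real_derivative
      (\<alpha> * \<beta> * - f t - signed_pow p (- g t)) - (\<beta> - \<alpha>) * - f' t) (at t)"
    using DERIV_minus[OF f'[of t]] by (simp add: algebra_simps)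
  show "((\<lambda>t. - g' t) has_real_derivative
      (\<alpha> * \<beta> * - g t - signed_pow q (- f t)) - (\<alpha> - \<beta>) * - g' t) (at t)"
    using DERIV_minus[OF g'[of t]] by (simp add: algebra_simps)
qed (auto intro!: p q DERIV_minus f g)

lemma isCont_f: "isCont f t" and isCont_g: "isCont g t"
  and isCont_f': "isCont f' t" and isCont_g': "isCont g' t"
  using f g f' g' by (blast intro: DERIV_isCont)+

lemma continuous_f: "continuous_on S f" and continuous_g: "continuous_on S g"
  and continuous_f': "continuous_on S f'" and continuous_g': "continuous_on S g'"
  by (simp_all add: continuous_at_imp_continuous_on isCont_f isCont_g isCont_f' isCont_g')

text \<open>The Hamiltonian of the system.\<close>

definition energy :: "real \<Rightarrow> real" where
  "energy t = f' t * g' t - \<alpha> * \<beta> * (f t * g t) + \<bar>f t\<bar> powr q / q + \<bar>g t\<bar> powr p / p"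

lemma energy_const: "energy s = energy t"
proof -
  have "(energy has_real_derivative 0) (at t)" for t
  proof -
    have "((\<lambda>t. \<bar>f t\<bar> powr q / q) has_real_derivative q * signed_pow q (f t) * f' t / q) (at t)"
      "((\<lambda>t. \<bar>g t\<bar> powr p / p) has_real_derivative p * signed_pow p (g t) * g' t / p) (at t)"
      by (rule DERIV_cdivide[OF DERIV_chain2[OF abs_powr_has_real_derivative]], rule q, rule f)
        (rule DERIV_cdivide[OF DERIV_chain2[OF abs_powr_has_real_derivative]], rule p, rule g)
    note d = DERIV_add[OF DERIV_add[OF DERIV_diff[OF DERIV_mult[OF f' g']
          DERIV_cmult[OF DERIV_mult[OF f g], of "\<alpha> * \<beta>"]] this(1)] this(2)]
    show ?thesis
      unfolding energy_def[abs_def]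
      by (rule DERIV_cong[OF d]) (use p q in \<open>simp add: algebra_simps\<close>)
  qed
  then show ?thesis
    by (rule DERIV_isconst_all[rule_format])
qed

lemma limits_at_top:
  assumes "(f \<longlongrightarrow> L) at_top" and "(g \<longlongrightarrow> M) at_top"
  shows "\<alpha> * \<beta> * L = signed_pow p M" and "\<alpha> * \<beta> * M = signed_pow q L"
    and "(f' \<longlongrightarrow> 0) at_top" and "(g' \<longlongrightarrow> 0) at_top"
proof -
  have hf: "((\<lambda>t. \<alpha> * \<beta> * f t - signed_pow p (g t)) \<longlongrightarrow> \<alpha> * \<beta> * L - signed_pow p M) at_top"
    by (intro tendsto_intros assms isCont_tendsto_compose[OF isCont_signed_pow[OF p]])
  have hg: "((\<lambda>t. \<alpha> * \<beta> * g t - signed_pow q (f t)) \<longlongrightarrow> \<alpha> * \<beta> * M - signed_pow q L) at_top"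
    by (intro tendsto_intros assms isCont_tendsto_compose[OF isCont_signed_pow[OF q]])
  show "\<alpha> * \<beta> * L = signed_pow p M" "(f' \<longlongrightarrow> 0) at_top"
    using limit_forces_derivative_limit[OF f f' assms(1) hf] by auto
  show "\<alpha> * \<beta> * M = signed_pow q L" "(g' \<longlongrightarrow> 0) at_top"
    using limit_forces_derivative_limit[OF g g' assms(2) hg] by auto
qed

lemma energy_zero:
  assumes "(f \<longlongrightarrow> 0) at_top" and "(g \<longlongrightarrow> 0) at_top"
  shows "energy t = 0"
proof -
  note d = limits_at_top(3,4)[OF assms]
  have "(energy \<longlongrightarrow> 0 * 0 - \<alpha> * \<beta> * (0 * 0) + \<bar>0\<bar> powr q / q + \<bar>0\<bar> powr p / p) at_top"
    unfolding energy_def[abs_def]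
    by (intro tendsto_add tendsto_diff tendsto_mult tendsto_divide tendsto_const assms d
        isCont_tendsto_compose[OF DERIV_isCont[OF abs_powr_has_real_derivative]] p q)
      (use p q in auto)
  moreover have "energy = (\<lambda>_. energy t)"
    using energy_const by blast
  ultimately have "((\<lambda>_::real. energy t) \<longlongrightarrow> 0) at_top"
    by (metis (no_types, lifting) abs_0 add_0 diff_0_right div_0 mult_zero_right powr_0)
  then show ?thesis
    by (simp add: tendsto_const_iff)
qed

section \<open>Solutions decaying at both ends\<close>

text \<open>
  As long as \<open>f > 0 > g\<close>, zero energy prevents \<open>f'\<close> and \<open>g'\<close> from vanishing; as long as
  \<open>f' > 0 > g'\<close>, the inequalities \<open>f > 0 > g\<close> persist. So \<open>f\<close> increases forever and stays away
  from its limit zero.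
\<close>

lemma runaway_forward:
  assumes ab: "\<alpha> * \<beta> \<ge> 0" and E: "\<And>t. energy t = 0"
    and lim: "(f \<longlongrightarrow> 0) at_top"
    and t0: "f t0 \<ge> 0" "g t0 \<le> 0" "f' t0 > 0" "g' t0 < 0"
  shows False
proof -
  have pos: "f' t > 0" and neg: "g' t < 0" if "t \<ge> t0" for t
  proof -
    define S where "S = {t0..} \<inter> ({t. f' t \<le> 0} \<union> {t. g' t \<ge> 0})"
    have "S = {}"
    proof (rule ccontr)
      assume ne: "S \<noteq> {}"
      define s where "s = Inf S"
      have bdd: "bdd_below S"
        by (auto simp: S_def bdd_below_def)
      have "closed S"
        unfolding S_def
        by (intro closed_Int closed_Un closed_Collect_le continuous_f' continuous_g'
            continuous_on_const closed_atLeast)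
      then have s: "s \<in> S"
        unfolding s_def using ne bdd by (intro closed_contains_Inf)
      have below: "f' x > 0 \<and> g' x < 0" if "t0 \<le> x" "x < s" for x
      proof -
        have "x \<notin> S"
          using that(2) bdd cInf_lower s_def by fastforce
        then show ?thesis
          using that(1) by (auto simp: S_def)
      qed
      have "t0 < s"
        using s t0(3,4) by (auto simp: S_def less_le)
      have "f t0 < f s"
        by (rule DERIV_pos_imp_increasing_open[OF \<open>t0 < s\<close>])
          (use below f less_imp_le in \<open>blast intro: continuous_f\<close>)+
      moreover have "g s < g t0"
        by (rule DERIV_neg_imp_decreasing_open[OF \<open>t0 < s\<close>])
          (use below g less_imp_le in \<open>blast intro: continuous_g\<close>)+
      ultimately have fg: "f s > 0" "g s < 0"
        using t0 by linarith+
      then have "f' s * g' s < 0"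
      proof -
        have "f' s * g' s = \<alpha> * \<beta> * (f s * g s) - \<bar>f s\<bar> powr q / q - \<bar>g s\<bar> powr p / p"
          using E[of s] by (simp add: energy_def)
        moreover have "\<alpha> * \<beta> * (f s * g s) \<le> 0"
          using fg ab by (intro mult_nonneg_nonpos) (auto simp: mult_nonneg_nonpos)
        moreover have "\<bar>f s\<bar> powr q / q > 0" "\<bar>g s\<bar> powr p / p > 0"
          using fg p q by auto
        ultimately show ?thesis by linarith
      qed
      \<comment> \<open>Since \<open>s \<in> S\<close>, the negative product leaves only \<open>f' s < 0 < g' s\<close>.\<close>
      then have "f' s < 0"
        using s by (auto simp: S_def mult_less_0_iff)
      then obtain x where "t0 \<le> x" "x \<le> s" "f' x = 0"
        using IVT2'[of f' s 0 t0] t0(3) \<open>t0 < s\<close> continuous_f' by force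
      then show False
        using below[of x] \<open>f' s < 0\<close> by (cases "x = s") auto
    qed
    then have "t \<notin> S" by simp
    then show "f' t > 0" "g' t < 0"
      using that by (auto simp: S_def)
  qed
  have inc: "f s < f t" if "t0 \<le> s" "s < t" for s t
    by (rule DERIV_pos_imp_increasing[OF that(2)]) (use that f pos in \<open>meson order_trans\<close>)
  have "f (t0 + 1) \<le> f t" if "t0 + 1 \<le> t" for t
    using inc[of "t0 + 1" t] that by (cases "t = t0 + 1") auto
  then have "f (t0 + 1) \<le> 0"
    by (intro tendsto_lowerbound[OF lim]) (auto simp: eventually_at_top_linorder)
  then show False
    using inc[of t0 "t0 + 1"] t0(1) by linarith
qed

lemma energy_swap: "emden_fowler.energy \<beta> \<alpha> q p g g' f f' t = energy t"
  unfolding energy_def emden_fowler.energy_def[OF swap] by (simp add: mult.commute)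

lemma energy_reflect:
  "emden_fowler.energy \<beta> \<alpha> p q (\<lambda>t. f (- t)) (\<lambda>t. - f' (- t)) (\<lambda>t. g (- t)) (\<lambda>t. - g' (- t)) t
   = energy (- t)"
  unfolding energy_def emden_fowler.energy_def[OF reflect] by (simp add: mult.commute)

lemma energy_negate:
  "emden_fowler.energy \<alpha> \<beta> p q (\<lambda>t. - f t) (\<lambda>t. - f' t) (\<lambda>t. - g t) (\<lambda>t. - g' t) t = energy t"
  unfolding energy_def emden_fowler.energy_def[OF negate] by simp

text \<open>
  Where \<open>f \<ge> 0 \<ge> g\<close> and not both vanish, zero energy gives the derivatives strictly opposite
  signs; the solution would run away forward in time if \<open>f' > 0\<close> and backward in time if \<open>f' < 0\<close>.
\<close>

lemma no_opposite_signs_ordered: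
  assumes ab: "\<alpha> * \<beta> \<ge> 0" and E: "\<And>t. energy t = 0"
    and top: "(f \<longlongrightarrow> 0) at_top" and bot: "(f \<longlongrightarrow> 0) at_bot"
    and t: "f t \<ge> 0" "g t \<le> 0"
  shows "f t = 0 \<and> g t = 0"
proof (rule ccontr)
  assume nz: "\<not> (f t = 0 \<and> g t = 0)"
  have "f' t * g' t = \<alpha> * \<beta> * (f t * g t) - \<bar>f t\<bar> powr q / q - \<bar>g t\<bar> powr p / p"
    using E[of t] by (simp add: energy_def)
  moreover have "\<alpha> * \<beta> * (f t * g t) \<le> 0"
    using t ab by (intro mult_nonneg_nonpos) (auto simp: mult_nonneg_nonpos)
  moreover have "\<bar>f t\<bar> powr q / q + \<bar>g t\<bar> powr p / p > 0"
    using nz p q by (auto intro: add_pos_nonneg add_nonneg_pos)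
  ultimately have "f' t * g' t < 0"
    by linarith
  then consider "f' t > 0" "g' t < 0" | "f' t < 0" "g' t > 0"
    by (auto simp: mult_less_0_iff)
  then show False
  proof cases
    case 1
    then show ?thesis
      using runaway_forward[OF ab E top t] by blast
  next
    case 2
    have "((\<lambda>t. f (- t)) \<longlongrightarrow> 0) at_top"
      using bot by (simp add: filterlim_at_bot_mirror)
    then show ?thesis
      using emden_fowler.runaway_forward[OF reflect, of "- t"] ab E t 2
      by (auto simp: energy_reflect mult.commute)
  qed
qed

lemma same_sign_or_zero:
  assumes ab: "\<alpha> * \<beta> \<ge> 0" and E: "\<And>t. energy t = 0"
    and f_lim: "(f \<longlongrightarrow> 0) at_top" "(f \<longlongrightarrow> 0) at_bot"
    and g_lim: "(g \<longlongrightarrow> 0) at_top" "(g \<longlongrightarrow> 0) at_bot"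
  shows "f t * g t > 0 \<or> (f t = 0 \<and> g t = 0)"
proof -
  consider "f t * g t > 0" | "f t \<ge> 0" "g t \<le> 0" | "f t \<le> 0" "g t \<ge> 0"
    by (auto simp: zero_less_mult_iff not_less) (meson linear not_le)
  then show ?thesis
  proof cases
    case 2
    then show ?thesis
      using no_opposite_signs_ordered[OF ab E f_lim] by blast
  next
    case 3
    then show ?thesis
      using emden_fowler.no_opposite_signs_ordered[OF swap, of t] ab E g_lim
      by (auto simp: energy_swap mult.commute)
  qed auto
qed

text \<open>
  Integrating the two first order factors of \<open>(D - \<beta>) (D + \<alpha>) g < 0\<close> one after the other.
\<close>

lemma negative_after_double_zero:
  assumes "s < t" and zero: "g s = 0" "g' s = 0" and pos: "\<And>x. s < x \<Longrightarrow> x \<le> t \<Longrightarrow> f x > 0"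
  shows "g t < 0"
proof -
  define W where "W x = exp (- \<beta> * x) * (g' x + \<alpha> * g x)" for x
  define Z where "Z x = exp (\<alpha> * x) * g x" for x
  have W: "(W has_real_derivative - exp (- \<beta> * x) * signed_pow q (f x)) (at x)" for x
    unfolding W_def by (rule derivative_eq_intros g g' refl | simp)+ (simp add: algebra_simps)
  have Z: "(Z has_real_derivative exp ((\<alpha> + \<beta>) * x) * W x) (at x)" for x
  proof -
    have "exp ((\<alpha> + \<beta>) * x) * exp (- \<beta> * x) = exp (\<alpha> * x)"
      by (simp add: algebra_simps flip: exp_add)
    then have "exp ((\<alpha> + \<beta>) * x) * W x = exp (\<alpha> * x) * (g' x + \<alpha> * g x)"
      unfolding W_def by (metis mult.assoc)
    then show ?thesis
      unfolding Z_def by (auto intro!: derivative_eq_intros g simp: algebra_simps)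
  qed
  have W_neg: "W x < 0" if "s < x" "x \<le> t" for x
  proof -
    have "W x < W s"
    proof (rule DERIV_neg_imp_decreasing_open[OF that(1)])
      fix y assume "s < y" "y < x"
      then show "\<exists>z. (W has_real_derivative z) (at y) \<and> z < 0"
        using W[of y] signed_pow_pos[OF pos[of y]] that by (intro exI conjI) auto
    qed (rule continuous_at_imp_continuous_on, use W in \<open>blast intro: DERIV_isCont\<close>)
    then show ?thesis
      by (simp add: W_def zero)
  qed
  have "Z t < Z s"
  proof (rule DERIV_neg_imp_decreasing_open[OF \<open>s < t\<close>])
    fix y assume "s < y" "y < t"
    then show "\<exists>z. (Z has_real_derivative z) (at y) \<and> z < 0"
      using Z[of y] W_neg[of y] by (meson exp_gt_zero less_imp_le mult_pos_neg)
  qed (rule continuous_at_imp_continuous_on, use Z in \<open>blast intro: DERIV_isCont\<close>)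
  then show ?thesis
    by (simp add: Z_def zero mult_less_0_iff)
qed

text \<open>
  At the last zero \<open>s\<close> of \<open>f\<close> before \<open>t1\<close> both functions vanish, and zero energy makes one of them
  vanish to second order. That one would have to be negative to the right of \<open>s\<close>, where both are
  positive.
\<close>

lemma zero_propagates_forward_pos:
  assumes E: "\<And>t. energy t = 0"
    and sign: "\<And>t. f t * g t > 0 \<or> (f t = 0 \<and> g t = 0)"
    and "f t0 = 0" "t0 < t1" "f t1 > 0"
  shows False
proof -
  define S where "S = {t0..t1} \<inter> {t. f t = 0}"
  define s where "s = Sup S"
  have "t0 \<in> S"
    using assms by (simp add: S_def)
  then have ne: "S \<noteq> {}" by blast
  have bdd: "bdd_above S"
    by (auto simp: S_def)
  have "closed S"
    unfolding S_def by (intro closed_Int closed_Collect_eq continuous_f continuous_on_const) auto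
  then have s: "s \<in> S"
    unfolding s_def using ne bdd by (intro closed_contains_Sup)
  then have fs: "f s = 0" and st: "s < t1"
    using \<open>f t1 > 0\<close> by (auto simp: S_def less_le)
  have nz: "f x \<noteq> 0" if "s < x" "x \<le> t1" for x
    using that cSup_upper[OF _ bdd, of x] s by (auto simp: S_def s_def)
  have fpos: "f x > 0" if x: "s < x" "x \<le> t1" for x
  proof (rule ccontr)
    assume "\<not> f x > 0"
    then obtain y where "x \<le> y" "y \<le> t1" "f y = 0"
      using IVT'[of f x 0 t1] \<open>f t1 > 0\<close> x(2) continuous_f by force
    then show False
      using nz[of y] x by auto
  qed
  have gpos: "g x > 0" if "s < x" "x \<le> t1" for x
    using sign[of x] fpos[OF that] by (auto simp: zero_less_mult_iff)
  have gs: "g s = 0"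
    using sign[of s] fs by simp
  have "f' s * g' s = 0"
    using E[of s] fs gs by (simp add: energy_def)
  then consider "g' s = 0" | "f' s = 0" by auto
  then show False
  proof cases
    case 1
    then show ?thesis
      using negative_after_double_zero[OF st gs] fpos gpos[of t1] st by fastforce
  next
    case 2
    then show ?thesis
      using emden_fowler.negative_after_double_zero[OF swap st fs] gpos fpos[of t1] st by fastforce
  qed
qed

lemma zero_propagates_forward:
  assumes E: "\<And>t. energy t = 0"
    and sign: "\<And>t. f t * g t > 0 \<or> (f t = 0 \<and> g t = 0)"
    and "f t0 = 0" "t0 < t1"
  shows "f t1 = 0"
proof (rule ccontr)
  assume "f t1 \<noteq> 0"
  then consider "f t1 > 0" | "- f t1 > 0" by linarith
  then show False
  proof cases
    case 1
    then show ?thesis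
      using zero_propagates_forward_pos[OF E sign] assms(3,4) by blast
  next
    case 2
    then show ?thesis
      using emden_fowler.zero_propagates_forward_pos[OF negate, of t0 t1] assms
      by (auto simp: energy_negate)
  qed
qed

lemma zero_propagates:
  assumes E: "\<And>t. energy t = 0"
    and sign: "\<And>t. f t * g t > 0 \<or> (f t = 0 \<and> g t = 0)"
    and "f t0 = 0"
  shows "f t = 0"
proof -
  consider "t0 < t" | "t < t0" | "t = t0" by linarith
  then show ?thesis
  proof cases
    case 1
    then show ?thesis
      using zero_propagates_forward[OF E sign] assms(3) by blast
  next
    case 2
    then show ?thesis
      using emden_fowler.zero_propagates_forward[OF reflect, of "- t0" "- t"] assms
      by (auto simp: energy_reflect)
  qed (use assms in auto)
qed

theorem decaying_solution_zero_or_same_sign: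
  assumes ab: "\<alpha> * \<beta> \<ge> 0"
    and f_lim: "(f \<longlongrightarrow> 0) at_top" "(f \<longlongrightarrow> 0) at_bot"
    and g_lim: "(g \<longlongrightarrow> 0) at_top" "(g \<longlongrightarrow> 0) at_bot"
  shows "(\<forall>t. f t = 0 \<and> g t = 0) \<or> (\<forall>t. f t * g t > 0)"
proof -
  note E = energy_zero[OF f_lim(1) g_lim(1)]
  note sign = same_sign_or_zero[OF ab E f_lim g_lim]
  show ?thesis
  proof (cases "\<exists>t0. f t0 = 0")
    case True
    then have "f t = 0" for t
      using zero_propagates[OF E sign] by blast
    then show ?thesis
      using sign by fastforce
  next
    case False
    then show ?thesis
      using sign by blast
  qed
qed

section \<open>Nonnegative solutions when \<open>\<alpha> \<beta> \<le> 0\<close>\<close>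

text \<open>
  The equation for \<open>f\<close> reads \<open>(exp ((\<beta> - \<alpha>) t) f')' = exp ((\<beta> - \<alpha>) t) (\<alpha> \<beta> f - g\<^sup>p\<^sup>-\<^sup>1) \<le> 0\<close>. The
  condition \<open>\<beta> \<le> \<alpha>\<close> keeps the exponential factor bounded at \<open>+\<infinity>\<close>.
\<close>

lemma nonneg_solution_zero:
  assumes ab: "\<alpha> * \<beta> \<le> 0" and c: "\<beta> \<le> \<alpha>"
    and nonneg: "\<And>t. f t \<ge> 0" "\<And>t. g t \<ge> 0"
    and lim: "(f \<longlongrightarrow> L) at_top" "(g \<longlongrightarrow> M) at_top"
  shows "f t = 0 \<and> g t = 0"
proof -
  have LM: "L \<ge> 0" "M \<ge> 0"
    using nonneg by (auto intro: tendsto_lowerbound[OF lim(1)] tendsto_lowerbound[OF lim(2)])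
  have "\<alpha> * \<beta> * M \<le> 0"
    using LM ab by (simp add: mult_nonpos_nonneg)
  \<comment> \<open>The limit of the equation for \<open>g\<close> equates this with \<open>L\<^sup>q\<^sup>-\<^sup>1 \<ge> 0\<close>.\<close>
  then have L: "L = 0"
    using limits_at_top(2)[OF lim] signed_pow_nonneg[OF LM(1), of q] by simp
  define F where "F x = exp ((\<beta> - \<alpha>) * x) * f' x" for x
  have F: "(F has_real_derivative
      exp ((\<beta> - \<alpha>) * x) * (\<alpha> * \<beta> * f x - signed_pow p (g x))) (at x)" for x
    unfolding F_def by (rule derivative_eq_intros f' refl | simp)+ (simp add: algebra_simps)
  have F_anti: "F y \<le> F x" if "x \<le> y" for x y
  proof (rule DERIV_nonpos_imp_nonincreasing[OF that])
    fix z
    have "\<alpha> * \<beta> * f z - signed_pow p (g z) \<le> 0"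
      using mult_nonpos_nonneg[OF ab nonneg(1)[of z]] signed_pow_nonneg[OF nonneg(2)[of z], of p]
      by linarith
    then show "\<exists>d. (F has_real_derivative d) (at z) \<and> d \<le> 0"
      using F by (blast intro: mult_nonneg_nonpos less_imp_le exp_gt_zero)
  qed
  have F_lim: "(F \<longlongrightarrow> 0) at_top"
  proof (rule Lim_null_comparison)
    show "((\<lambda>x. \<bar>f' x\<bar>) \<longlongrightarrow> 0) at_top"
      using limits_at_top(3)[OF lim] by (rule tendsto_rabs_zero)
    have "\<bar>F x\<bar> \<le> \<bar>f' x\<bar>" if "x \<ge> 0" for x
    proof -
      have "exp ((\<beta> - \<alpha>) * x) \<le> 1"
        using c that by (simp add: mult_nonpos_nonneg)
      then show ?thesis
        unfolding F_def abs_mult by (intro mult_left_le_one_le) auto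
    qed
    then show "\<forall>\<^sub>F x in at_top. norm (F x) \<le> \<bar>f' x\<bar>"
      by (auto simp: eventually_at_top_linorder)
  qed
  have "F x \<ge> 0" for x
    by (rule tendsto_upperbound[OF F_lim]) (auto simp: eventually_at_top_linorder intro: F_anti)
  then have "f' x \<ge> 0" for x
    by (metis F_def exp_gt_zero zero_le_mult_iff not_le)
  then have mono: "f x \<le> f y" if "x \<le> y" for x y
    using DERIV_nonneg_imp_nondecreasing[OF that] f by blast
  have "f x \<le> 0" for x
    using lim(1) unfolding L
    by (rule tendsto_lowerbound) (auto simp: eventually_at_top_linorder intro: mono)
  then have fz: "f x = 0" for x
    using nonneg(1) antisym by blast
  then have "f' = (\<lambda>x. 0)"
    using f DERIV_unique[OF _ DERIV_const] by (metis (no_types, lifting) ext)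
  then have "signed_pow p (g t) = 0"
    using DERIV_unique[OF f'[of t], of 0] fz by simp
  then show ?thesis
    using fz by simp
qed

text \<open>
  Swapping and reflecting together preserve \<open>\<alpha>\<close> and \<open>\<beta>\<close>, so the same condition \<open>\<beta> \<le> \<alpha>\<close> serves
  at \<open>-\<infinity>\<close>.
\<close>

lemma nonneg_solution_zero_at_bot:
  assumes ab: "\<alpha> * \<beta> \<le> 0" and c: "\<beta> \<le> \<alpha>"
    and nonneg: "\<And>t. f t \<ge> 0" "\<And>t. g t \<ge> 0"
    and lim: "(f \<longlongrightarrow> L) at_bot" "(g \<longlongrightarrow> M) at_bot"
  shows "f t = 0 \<and> g t = 0"
proof -
  interpret R: emden_fowler \<alpha> \<beta> q p "\<lambda>t. g (- t)" "\<lambda>t. - g' (- t)" "\<lambda>t. f (- t)" "\<lambda>t. - f' (- t)"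
    by (rule emden_fowler.reflect[OF swap])
  have "g (- (- t)) = 0 \<and> f (- (- t)) = 0"
    by (rule R.nonneg_solution_zero[OF ab c])
      (use nonneg lim in \<open>auto simp: filterlim_at_bot_mirror\<close>)
  then show ?thesis by simp
qed

end

section \<open>Radial functions\<close>

lemma has_real_derivative_along_ray:
  assumes "g differentiable (at (r *\<^sub>R e))"
  shows "((\<lambda>r. g (r *\<^sub>R e)) has_real_derivative partial_deriv e g (r *\<^sub>R e)) (at r)"
proof -
  let ?D = "frechet_derivative g (at (r *\<^sub>R e))"
  have D: "(g has_derivative ?D) (at (r *\<^sub>R e))"
    using assms frechet_derivative_works by blast
  have "((\<lambda>r. g (r *\<^sub>R e)) has_derivative (\<lambda>h. ?D (h *\<^sub>R e))) (at r)"
    using D by (rule has_derivative_compose[rotated]) (auto intro!: derivative_eq_intros)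
  moreover have "?D (h *\<^sub>R e) = partial_deriv e g (r *\<^sub>R e) * h" for h
    using linear_scale[OF has_derivative_linear[OF D], of h e]
    by (simp add: partial_deriv_def)
  ultimately show ?thesis
    by (simp add: has_field_derivative_def)
qed

lemma partial_deriv_eqI: "(f has_derivative D) (at x) \<Longrightarrow> partial_deriv i f x = D i"
  by (simp add: partial_deriv_def flip: frechet_derivative_at)

lemma sum_Basis_inner_square: "(\<Sum>i\<in>Basis. (i \<bullet> x)\<^sup>2) = (norm x)\<^sup>2"
  unfolding power2_norm_eq_inner
  by (subst euclidean_inner) (simp add: power2_eq_square inner_commute)

lemma radial_laplacian:
  fixes u :: "'a::euclidean_space \<Rightarrow> real"
  assumes rad: "\<And>x. x \<noteq> 0 \<Longrightarrow> u x = U (norm x)"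
    and U: "\<And>r. r > 0 \<Longrightarrow> (U has_real_derivative U' r) (at r)"
    and U': "\<And>r. r > 0 \<Longrightarrow> (U' has_real_derivative U'' r) (at r)"
    and "x \<noteq> 0"
  shows "laplacian u x = U'' (norm x) + (real DIM('a) - 1) / norm x * U' (norm x)"
proof -
  have chain: "((\<lambda>y. h (norm y)) has_derivative (\<lambda>k. d * (k \<bullet> sgn y))) (at y)"
    if "(h has_real_derivative d) (at (norm y))" "y \<noteq> 0" for h d and y :: 'a
    using has_derivative_compose[OF has_derivative_norm[OF that(2)]
        that(1)[unfolded has_field_derivative_def]] .
  have first: "partial_deriv i u y = U' (norm y) * ((i \<bullet> y) / norm y)" if "y \<noteq> 0" for i y
  proof -
    have "(u has_derivative (\<lambda>k. U' (norm y) * (k \<bullet> sgn y))) (at y)"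
      by (rule has_derivative_transform_within_open[OF chain[OF U], where s = "- {0}"])
        (use that rad in auto)
    then show ?thesis
      by (simp add: partial_deriv_eqI sgn_div_norm divide_inverse mult.commute)
  qed
  have second: "partial_deriv i (partial_deriv i u) x
      = (U'' (norm x) / (norm x)\<^sup>2 - U' (norm x) / (norm x) ^ 3) * (i \<bullet> x)\<^sup>2
        + U' (norm x) / norm x" if "i \<in> Basis" for i
  proof -
    let ?D = "\<lambda>k. U' (norm x) * (((i \<bullet> k) * norm x - (i \<bullet> x) * (k \<bullet> sgn x)) / (norm x * norm x))
         + U'' (norm x) * (k \<bullet> sgn x) * ((i \<bullet> x) / norm x)"
    have "((\<lambda>y. U' (norm y) * ((i \<bullet> y) / norm y)) has_derivative ?D) (at x)"
      using \<open>x \<noteq> 0\<close>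
      by (intro has_derivative_mult chain U' has_derivative_divide' has_derivative_norm
          bounded_linear.has_derivative[OF bounded_linear_inner_right] has_derivative_ident) auto
    then have "(partial_deriv i u has_derivative ?D) (at x)"
      by (rule has_derivative_transform_within_open[where s = "- {0}"])
        (use \<open>x \<noteq> 0\<close> first in auto)
    then have "partial_deriv i (partial_deriv i u) x = ?D i"
      by (rule partial_deriv_eqI)
    also have "i \<bullet> sgn x = (i \<bullet> x) / norm x"
      by (simp add: sgn_div_norm divide_inverse mult.commute)
    finally show ?thesis
      using that \<open>x \<noteq> 0\<close> by (simp add: field_simps power2_eq_square power3_eq_cube)
  qed
  have "laplacian u x = (U'' (norm x) / (norm x)\<^sup>2 - U' (norm x) / (norm x) ^ 3) * (norm x)\<^sup>2
      + real DIM('a) * (U' (norm x) / norm x)"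
    unfolding laplacian_def
    by (simp add: second sum.distrib flip: sum_distrib_left sum_Basis_inner_square)
  also have "(U'' (norm x) / (norm x)\<^sup>2 - U' (norm x) / (norm x) ^ 3) * (norm x)\<^sup>2
      = U'' (norm x) - U' (norm x) / norm x"
    using \<open>x \<noteq> 0\<close> by (simp add: left_diff_distrib power2_eq_square power3_eq_cube)
  finally show ?thesis
    by (simp add: left_diff_distrib diff_divide_distrib)
qed

text \<open>
  The profile \<open>U\<close> is the restriction of \<open>u\<close> to the positive half of a coordinate axis, where \<open>U'\<close>
  and \<open>U''\<close> are partial derivatives of \<open>u\<close>; values at \<open>r \<le> 0\<close> are irrelevant.
\<close>

lemma radial_profile:
  fixes u :: "'a::euclidean_space \<Rightarrow> real"
  assumes C2: "C_on 2 (- {0}) u" and rad: "radial_on (- {0}) u"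
  obtains U U' U'' :: "real \<Rightarrow> real" where
    "\<And>x. x \<noteq> 0 \<Longrightarrow> u x = U (norm x)"
    "\<And>r. r > 0 \<Longrightarrow> (U has_real_derivative U' r) (at r)"
    "\<And>r. r > 0 \<Longrightarrow> (U' has_real_derivative U'' r) (at r)"
    "\<And>x. x \<noteq> 0 \<Longrightarrow> laplacian u x = U'' (norm x) + (real DIM('a) - 1) / norm x * U' (norm x)"
proof -
  obtain e :: 'a where e: "e \<in> Basis"
    using nonempty_Basis by blast
  then have nz: "r *\<^sub>R e \<noteq> 0" if "r > 0" for r
    using that nonzero_Basis by auto
  define U where "U r = u (r *\<^sub>R e)" for r
  define U' where "U' r = partial_deriv e u (r *\<^sub>R e)" for r
  define U'' where "U'' r = partial_deriv e (partial_deriv e u) (r *\<^sub>R e)" for r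
  have diff: "u differentiable (at x)" "partial_deriv e u differentiable (at x)" if "x \<noteq> 0" for x
    using C2 e that by (auto simp: numeral_2_eq_2)
  have 1: "u x = U (norm x)" if "x \<noteq> 0" for x
  proof -
    have "norm x *\<^sub>R e \<noteq> 0" "norm x = norm (norm x *\<^sub>R e)"
      using that nz[of "norm x"] e by auto
    then show ?thesis
      using rad that unfolding radial_on_def U_def by blast
  qed
  have 2: "(U has_real_derivative U' r) (at r)" if "r > 0" for r
    unfolding U_def U'_def by (rule has_real_derivative_along_ray[OF diff(1)[OF nz[OF that]]])
  have 3: "(U' has_real_derivative U'' r) (at r)" if "r > 0" for r
    unfolding U'_def U''_def by (rule has_real_derivative_along_ray[OF diff(2)[OF nz[OF that]]])
  show thesis
    by (rule that[OF 1 2 3 radial_laplacian[OF 1 2 3]])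
qed

section \<open>Logarithmic radius\<close>

text \<open>
  The weighted profile \<open>r\<^sup>\<alpha> U r\<close> as a function of the logarithmic radius \<open>t = ln r\<close>.
\<close>

definition log_profile :: "real \<Rightarrow> (real \<Rightarrow> real) \<Rightarrow> real \<Rightarrow> real" where
  "log_profile \<alpha> U t = exp (\<alpha> * t) * U (exp t)"

lemma log_profile_has_real_derivative:
  assumes "(U has_real_derivative d) (at (exp t))"
  shows "(log_profile \<alpha> U has_real_derivative exp (\<alpha> * t) * (\<alpha> * U (exp t) + exp t * d)) (at t)"
proof -
  have "((\<lambda>t. U (exp t)) has_real_derivative d * exp t) (at t)"
    by (rule DERIV_chain2[OF assms DERIV_exp])
  then show ?thesis
    unfolding log_profile_def[abs_def]
    by (auto intro!: derivative_eq_intros simp: algebra_simps)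
qed

text \<open>
  The condition \<open>\<alpha> + a + 2 = \<beta> (p - 1)\<close> makes the powers of \<open>r\<close> cancel, which is why the
  resulting equation is autonomous; the one on \<open>\<alpha> + \<beta>\<close> gives the coefficient of the first
  derivative \<open>log_profile \<alpha> (\<lambda>r. \<alpha> * U r + r * U' r)\<close>.
\<close>

lemma log_profile_equation:
  fixes U U' U'' V :: "real \<Rightarrow> real" and N :: real
  assumes U: "\<And>r. r > 0 \<Longrightarrow> (U has_real_derivative U' r) (at r)"
    and U': "\<And>r. r > 0 \<Longrightarrow> (U' has_real_derivative U'' r) (at r)"
    and eq: "\<And>r. r > 0 \<Longrightarrow>
      - (U'' r + (N - 1) / r * U' r) = r powr a * signed_pow p (V r)"
    and dim: "\<alpha> + \<beta> = N - 2" and hom: "\<alpha> + a + 2 = \<beta> * (p - 1)"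
  shows "(log_profile \<alpha> (\<lambda>r. \<alpha> * U r + r * U' r) has_real_derivative
      (\<alpha> * \<beta> * log_profile \<alpha> U t - signed_pow p (log_profile \<beta> V t))
      - (\<beta> - \<alpha>) * log_profile \<alpha> (\<lambda>r. \<alpha> * U r + r * U' r) t) (at t)"
proof -
  define r where "r = exp t"
  have "r > 0" by (simp add: r_def)
  have "((\<lambda>r. \<alpha> * U r + r * U' r) has_real_derivative
      \<alpha> * U' r + (1 * U' r + U'' r * r)) (at r)"
    by (intro DERIV_add DERIV_cmult DERIV_mult DERIV_ident U U' \<open>r > 0\<close>)
  then have D: "(log_profile \<alpha> (\<lambda>r. \<alpha> * U r + r * U' r) has_real_derivative
      exp (\<alpha> * t) * (\<alpha> * (\<alpha> * U r + r * U' r) + r * (\<alpha> * U' r + (U' r + U'' r * r)))) (at t)"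
    using log_profile_has_real_derivative unfolding r_def by fastforce
  have "exp (\<alpha> * t) * r\<^sup>2 * r powr a = exp (\<beta> * t) powr (p - 1)"
  proof -
    have "exp (\<alpha> * t) * r\<^sup>2 * r powr a = exp (\<alpha> * t) * (exp t * exp t) * exp (a * t)"
      by (simp add: r_def exp_powr_real power2_eq_square mult.commute[of t])
    also have "\<dots> = exp (\<alpha> * t + (t + t) + a * t)"
      by (simp only: exp_add)
    also have "\<alpha> * t + (t + t) + a * t = \<beta> * t * (p - 1)"
      using arg_cong[OF hom, of "(*) t"] by (simp add: algebra_simps)
    finally show ?thesis
      by (simp add: exp_powr_real)
  qed
  then have S: "signed_pow p (log_profile \<beta> V t)
      = exp (\<alpha> * t) * (r\<^sup>2 * (r powr a * signed_pow p (V r)))"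
    by (simp add: log_profile_def signed_pow_scale r_def)
  have "r\<^sup>2 * (r powr a * signed_pow p (V r)) = - (r\<^sup>2 * U'' r + (N - 1) * (r * U' r))"
    using \<open>r > 0\<close> unfolding eq[OF \<open>r > 0\<close>, symmetric]
    by (simp add: field_simps power2_eq_square)
  moreover have "N = \<alpha> + \<beta> + 2" using dim by simp
  ultimately have D_eq: "\<alpha> * (\<alpha> * U r + r * U' r) + r * (\<alpha> * U' r + (U' r + U'' r * r))
      = \<alpha> * \<beta> * U r - r\<^sup>2 * (r powr a * signed_pow p (V r)) - (\<beta> - \<alpha>) * (\<alpha> * U r + r * U' r)"
    by (simp add: algebra_simps power2_eq_square)
  show ?thesis
    unfolding S
    by (rule DERIV_cong[OF D]) (unfold D_eq, simp add: log_profile_def algebra_simps flip: r_def)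
qed

lemma emden_fowler_log_profile:
  fixes U U' U'' V V' V'' :: "real \<Rightarrow> real" and N :: real
  assumes pq: "p > 1" "q > 1"
    and U: "\<And>r. r > 0 \<Longrightarrow> (U has_real_derivative U' r) (at r)"
      "\<And>r. r > 0 \<Longrightarrow> (U' has_real_derivative U'' r) (at r)"
    and V: "\<And>r. r > 0 \<Longrightarrow> (V has_real_derivative V' r) (at r)"
      "\<And>r. r > 0 \<Longrightarrow> (V' has_real_derivative V'' r) (at r)"
    and eqU: "\<And>r. r > 0 \<Longrightarrow> - (U'' r + (N - 1) / r * U' r) = r powr a * signed_pow p (V r)"
    and eqV: "\<And>r. r > 0 \<Longrightarrow> - (V'' r + (N - 1) / r * V' r) = r powr b * signed_pow q (U r)"
    and dim: "(a + N) / p + (b + N) / q = N - 2"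
    and \<alpha>: "\<alpha> = (b + N) / q" and \<beta>: "\<beta> = (a + N) / p"
  shows "emden_fowler \<alpha> \<beta> p q
    (log_profile \<alpha> U) (log_profile \<alpha> (\<lambda>r. \<alpha> * U r + r * U' r))
    (log_profile \<beta> V) (log_profile \<beta> (\<lambda>r. \<beta> * V r + r * V' r))"
proof -
  have sum: "\<alpha> + \<beta> = N - 2"
    using dim by (simp add: \<alpha> \<beta>)
  have "\<beta> * p = a + N" "\<alpha> * q = b + N"
    using pq by (simp_all add: \<alpha> \<beta>)
  then have hom: "\<alpha> + a + 2 = \<beta> * (p - 1)" "\<beta> + b + 2 = \<alpha> * (q - 1)"
    using sum by (simp_all add: algebra_simps)
  show ?thesis
  proof unfold_locales
    fix t
    show "(log_profile \<alpha> U has_real_derivative log_profile \<alpha> (\<lambda>r. \<alpha> * U r + r * U' r) t) (at t)"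
      using log_profile_has_real_derivative[OF U(1)[of "exp t"]] by (simp add: log_profile_def)
    show "(log_profile \<beta> V has_real_derivative log_profile \<beta> (\<lambda>r. \<beta> * V r + r * V' r) t) (at t)"
      using log_profile_has_real_derivative[OF V(1)[of "exp t"]] by (simp add: log_profile_def)
    show "(log_profile \<alpha> (\<lambda>r. \<alpha> * U r + r * U' r) has_real_derivative
      (\<alpha> * \<beta> * log_profile \<alpha> U t - signed_pow p (log_profile \<beta> V t))
      - (\<beta> - \<alpha>) * log_profile \<alpha> (\<lambda>r. \<alpha> * U r + r * U' r) t) (at t)"
      by (rule log_profile_equation[OF U eqU sum hom(1)])
    show "(log_profile \<beta> (\<lambda>r. \<beta> * V r + r * V' r) has_real_derivative
      (\<alpha> * \<beta> * log_profile \<beta> V t - signed_pow q (log_profile \<alpha> U t))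
      - (\<alpha> - \<beta>) * log_profile \<beta> (\<lambda>r. \<beta> * V r + r * V' r) t) (at t)"
      using log_profile_equation[OF V eqV _ hom(2), of t] sum
      by (simp add: add.commute mult.commute[of \<beta> \<alpha>])
  qed (use pq in auto)
qed

lemma log_profile_limits:
  fixes u :: "'a::euclidean_space \<Rightarrow> real"
  assumes rad: "\<And>x. x \<noteq> 0 \<Longrightarrow> u x = U (norm x)"
  shows "((\<lambda>x. norm x powr \<alpha> * u x) \<longlongrightarrow> L) at_infinity \<Longrightarrow> (log_profile \<alpha> U \<longlongrightarrow> L) at_top"
    and "((\<lambda>x. norm x powr \<alpha> * u x) \<longlongrightarrow> L) (at 0) \<Longrightarrow> (log_profile \<alpha> U \<longlongrightarrow> L) at_bot"
proof -
  obtain e :: 'a where "e \<in> Basis"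
    using nonempty_Basis by blast
  then have e: "norm e = 1" "e \<noteq> 0" by auto
  have profile: "log_profile \<alpha> U = (\<lambda>t. norm (exp t *\<^sub>R e) powr \<alpha> * u (exp t *\<^sub>R e))"
    using e by (auto simp: log_profile_def rad exp_powr_real mult.commute)
  have "filterlim (\<lambda>t. norm (exp t *\<^sub>R e)) at_top at_top"
    using e exp_at_top by simp
  then have "filterlim (\<lambda>t. exp t *\<^sub>R e) at_infinity at_top"
    by (rule filterlim_norm_at_top_imp_at_infinity)
  then show "(log_profile \<alpha> U \<longlongrightarrow> L) at_top"
    if "((\<lambda>x. norm x powr \<alpha> * u x) \<longlongrightarrow> L) at_infinity"
    unfolding profile using filterlim_compose[OF that] by blast
  have "((\<lambda>t. exp t *\<^sub>R e) \<longlongrightarrow> 0 *\<^sub>R e) at_bot"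
    by (intro tendsto_scaleR exp_at_bot tendsto_const)
  then have "filterlim (\<lambda>t. exp t *\<^sub>R e) (at 0) at_bot"
    using e by (simp add: filterlim_at)
  then show "(log_profile \<alpha> U \<longlongrightarrow> L) at_bot"
    if "((\<lambda>x. norm x powr \<alpha> * u x) \<longlongrightarrow> L) (at 0)"
    unfolding profile using filterlim_compose[OF that] by blast
qed

section \<open>The dichotomy and the Liouville property\<close>

theorem theorem3p2:
  fixes u v :: "real ^ 'n \<Rightarrow> real" and n :: nat and a b p q :: real
  assumes "n = CARD('n)" and "n \<ge> 2" and "p > 1" and "q > 1"
    and "1 / p + 1 / q < 1"
    and "(a + real n) / p + (b + real n) / q = real n - 2"
    and "C_on 2 (- {0}) u" and "C_on 2 (- {0}) v"
    and "radial_on (- {0}) u" and "radial_on (- {0}) v"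
    and "\<forall>x. x \<noteq> 0 \<longrightarrow> - laplacian u x = norm x powr a * signed_pow p (v x)"
    and "\<forall>x. x \<noteq> 0 \<longrightarrow> - laplacian v x = norm x powr b * signed_pow q (u x)"
  shows
    "(a > - real n \<and> b > - real n \<and>
      ((\<lambda>x. norm x powr ((b + real n) / q) * u x) \<longlongrightarrow> 0) at_infinity \<and>
      ((\<lambda>x. norm x powr ((b + real n) / q) * u x) \<longlongrightarrow> 0) (at 0) \<and>
      ((\<lambda>x. norm x powr ((a + real n) / p) * v x) \<longlongrightarrow> 0) at_infinity \<and>
      ((\<lambda>x. norm x powr ((a + real n) / p) * v x) \<longlongrightarrow> 0) (at 0)
      \<longrightarrow> (\<forall>x. x \<noteq> 0 \<longrightarrow> u x = 0 \<and> v x = 0) \<or> (\<forall>x. x \<noteq> 0 \<longrightarrow> u x * v x > 0))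
     \<and>
     (((\<exists>L. ((\<lambda>x. norm x powr ((b + real n) / q) * u x) \<longlongrightarrow> L) at_infinity) \<and>
       (\<exists>M. ((\<lambda>x. norm x powr ((a + real n) / p) * v x) \<longlongrightarrow> M) at_infinity) \<or>
       (\<exists>L. ((\<lambda>x. norm x powr ((b + real n) / q) * u x) \<longlongrightarrow> L) (at 0)) \<and>
       (\<exists>M. ((\<lambda>x. norm x powr ((a + real n) / p) * v x) \<longlongrightarrow> M) (at 0))) \<and>
      (a \<le> - real n \<or> b \<le> - real n) \<and>
      (\<forall>x. x \<noteq> 0 \<longrightarrow> u x \<ge> 0 \<and> v x \<ge> 0)
      \<longrightarrow> (\<forall>x. x \<noteq> 0 \<longrightarrow> u x = 0 \<and> v x = 0))"
proof -
  have N: "real DIM(real ^ 'n) = real n"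
    using assms(1) by simp
  define \<alpha> \<beta> where "\<alpha> = (b + real n) / q" and "\<beta> = (a + real n) / p"
  note ab_def = this
  have sum: "\<alpha> + \<beta> \<ge> 0"
    using assms(2,6) by (simp add: ab_def)
  obtain U U' U'' where U: "\<And>x. x \<noteq> 0 \<Longrightarrow> u x = U (norm x)"
    "\<And>r. r > 0 \<Longrightarrow> (U has_real_derivative U' r) (at r)"
    "\<And>r. r > 0 \<Longrightarrow> (U' has_real_derivative U'' r) (at r)"
    "\<And>x. x \<noteq> 0 \<Longrightarrow> laplacian u x = U'' (norm x) + (real n - 1) / norm x * U' (norm x)"
    using radial_profile[OF assms(7,9)] unfolding N by blast
  obtain V V' V'' where V: "\<And>x. x \<noteq> 0 \<Longrightarrow> v x = V (norm x)"
    "\<And>r. r > 0 \<Longrightarrow> (V has_real_derivative V' r) (at r)"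
    "\<And>r. r > 0 \<Longrightarrow> (V' has_real_derivative V'' r) (at r)"
    "\<And>x. x \<noteq> 0 \<Longrightarrow> laplacian v x = V'' (norm x) + (real n - 1) / norm x * V' (norm x)"
    using radial_profile[OF assms(8,10)] unfolding N by blast
  have sphere: "\<exists>x :: real ^ 'n. x \<noteq> 0 \<and> norm x = r" if "r > 0" for r
    using that vector_choose_size[of r] by (metis less_irrefl less_imp_le norm_zero)
  have eqU: "- (U'' r + (real n - 1) / r * U' r) = r powr a * signed_pow p (V r)"
    and eqV: "- (V'' r + (real n - 1) / r * V' r) = r powr b * signed_pow q (U r)" if "r > 0" for r
    using sphere[OF that] assms(11,12) U(1,4) V(1,4) by metis+
  define f g where "f = log_profile \<alpha> U" and "g = log_profile \<beta> V"
  note fg_def = this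
  interpret emden_fowler \<alpha> \<beta> p q f "log_profile \<alpha> (\<lambda>r. \<alpha> * U r + r * U' r)"
      g "log_profile \<beta> (\<lambda>r. \<beta> * V r + r * V' r)"
    unfolding fg_def
    using emden_fowler_log_profile[OF assms(3,4) U(2,3) V(2,3) eqU eqV assms(6) ab_def] .
  note lim_u = log_profile_limits[where u = u and \<alpha> = \<alpha>, OF U(1), folded fg_def]
    and lim_v = log_profile_limits[where u = v and \<alpha> = \<beta>, OF V(1), folded fg_def]
  have f_ln: "f (ln (norm x)) = norm x powr \<alpha> * u x"
    and g_ln: "g (ln (norm x)) = norm x powr \<beta> * v x" if "x \<noteq> 0" for x
    using that by (auto simp: fg_def log_profile_def U(1) V(1) powr_def)
  show ?thesis
    unfolding ab_def[symmetric]
  proof (intro conjI impI; elim conjE)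
    assume "a > - real n" "b > - real n"
    then have "\<alpha> * \<beta> \<ge> 0"
      using assms(3,4) by (simp add: ab_def)
    moreover assume "((\<lambda>x. norm x powr \<alpha> * u x) \<longlongrightarrow> 0) at_infinity"
      "((\<lambda>x. norm x powr \<alpha> * u x) \<longlongrightarrow> 0) (at 0)"
      "((\<lambda>x. norm x powr \<beta> * v x) \<longlongrightarrow> 0) at_infinity"
      "((\<lambda>x. norm x powr \<beta> * v x) \<longlongrightarrow> 0) (at 0)"
    ultimately have "(\<forall>t. f t = 0 \<and> g t = 0) \<or> (\<forall>t. f t * g t > 0)"
      by (intro decaying_solution_zero_or_same_sign lim_u lim_v)
    then show "(\<forall>x. x \<noteq> 0 \<longrightarrow> u x = 0 \<and> v x = 0) \<or> (\<forall>x. x \<noteq> 0 \<longrightarrow> u x * v x > 0)"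
    proof
      assume "\<forall>t. f t = 0 \<and> g t = 0"
      then have "u x = 0 \<and> v x = 0" if "x \<noteq> 0" for x
        using f_ln[OF that] g_ln[OF that] that by simp
      then show ?thesis by blast
    next
      assume pos: "\<forall>t. f t * g t > 0"
      have "u x * v x > 0" if "x \<noteq> 0" for x
        using pos[rule_format, of "ln (norm x)"] f_ln[OF that] g_ln[OF that] that
        by (auto simp: zero_less_mult_iff mult_less_0_iff)
      then show ?thesis by blast
    qed
  next
    assume lim: "(\<exists>L. ((\<lambda>x. norm x powr \<alpha> * u x) \<longlongrightarrow> L) at_infinity) \<and>
        (\<exists>M. ((\<lambda>x. norm x powr \<beta> * v x) \<longlongrightarrow> M) at_infinity) \<or>
        (\<exists>L. ((\<lambda>x. norm x powr \<alpha> * u x) \<longlongrightarrow> L) (at 0)) \<and>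
        (\<exists>M. ((\<lambda>x. norm x powr \<beta> * v x) \<longlongrightarrow> M) (at 0))"
      and small: "a \<le> - real n \<or> b \<le> - real n"
      and nonneg: "\<forall>x. x \<noteq> 0 \<longrightarrow> u x \<ge> 0 \<and> v x \<ge> 0"
    have fg_nonneg: "f t \<ge> 0" "g t \<ge> 0" for t
      using sphere[of "exp t"] nonneg by (auto simp: fg_def log_profile_def U(1) V(1))
    have le0: "\<beta> \<le> 0 \<or> \<alpha> \<le> 0"
      using small assms(3,4) by (auto simp: ab_def divide_nonpos_pos)
    then have "\<alpha> * \<beta> \<le> 0"
      using sum by (auto simp: mult_le_0_iff)
    have lim_fg: "(\<exists>L M. (f \<longlongrightarrow> L) at_top \<and> (g \<longlongrightarrow> M) at_top)
        \<or> (\<exists>L M. (f \<longlongrightarrow> L) at_bot \<and> (g \<longlongrightarrow> M) at_bot)"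
      using lim lim_u lim_v by blast
    have zero: "f t = 0 \<and> g t = 0" for t
      using le0
    proof
      assume "\<beta> \<le> 0"
      then have "\<beta> \<le> \<alpha>" using sum by linarith
      then show ?thesis
        using lim_fg nonneg_solution_zero[OF \<open>\<alpha> * \<beta> \<le> 0\<close> _ fg_nonneg]
          nonneg_solution_zero_at_bot[OF \<open>\<alpha> * \<beta> \<le> 0\<close> _ fg_nonneg] by blast
    next
      assume "\<alpha> \<le> 0"
      then have "\<alpha> \<le> \<beta>" using sum by linarith
      moreover have "\<beta> * \<alpha> \<le> 0"
        using \<open>\<alpha> * \<beta> \<le> 0\<close> by (simp add: mult.commute)
      ultimately show ?thesis
        using lim_fg emden_fowler.nonneg_solution_zero[OF swap _ _ fg_nonneg(2,1)]
          emden_fowler.nonneg_solution_zero_at_bot[OF swap _ _ fg_nonneg(2,1)] by blast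
    qed
    show "\<forall>x. x \<noteq> 0 \<longrightarrow> u x = 0 \<and> v x = 0"
    proof (intro allI impI)
      fix x :: "real ^ 'n" assume "x \<noteq> 0"
      then show "u x = 0 \<and> v x = 0"
        using zero[of "ln (norm x)"] f_ln[of x] g_ln[of x] by simp
    qed
  qed
qed

end
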